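(* If $H$ is a finite chordal graph with clique number $\omega(H)=3$, then $\chi_{\mathrm{g}}^{(2)}(H) \le 4$.
   Context: The $k$-clique-relaxed $n$-coloring game on a finite graph $G$: there is a fixed set of $n$ colors; Alice moves first, and Alice and Bob alternately choose an uncolored vertex and assign it one of the $n$ colors, subject to the rule that at no point may there be a monochromatic clique on $k+1$ vertices. Alice wins if the game ends with all vertices colored; Bob wins if at some point an uncolored vertex has no legal color. $\chi_{\mathrm{g}}^{(k)}(G)$ is the least $n$ such that Alice has a winning strategy. Here $k=2$, so the forbidden monochromatic cliques are triangles. A graph is chordal if it has no induced cycle of length at least 4. *)

theory Defs
  imports "Graph_Theory.Digraph"
begin

text \<open>
  Finite simple graphs are the locale \<^locale>\<open>graph\<close>: finite, loop-free, symmetric digraphs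
  without parallel arcs, with adjacency \<^term>\<open>u \<rightarrow>\<^bsub>G\<^esub> v\<close>.
\<close>

definition is_clique :: "('a, 'b) pre_digraph \<Rightarrow> 'a set \<Rightarrow> bool" where
  "is_clique G K \<longleftrightarrow> K \<subseteq> verts G \<and> (\<forall>u\<in>K. \<forall>v\<in>K. u \<noteq> v \<longrightarrow> u \<rightarrow>\<^bsub>G\<^esub> v)"

definition clique_number :: "('a, 'b) pre_digraph \<Rightarrow> nat" where
  "clique_number G = Max {card K |K. is_clique G K}"

text \<open>
  The list of vertices of an induced cycle, in cyclic order: consecutive vertices are adjacent,
  and there are no other adjacencies.
\<close>

definition induced_cycle :: "('a, 'b) pre_digraph \<Rightarrow> 'a list \<Rightarrow> bool" where
  "induced_cycle G vs \<longleftrightarrow> 3 \<le> length vs \<and> distinct vs \<and> set vs \<subseteq> verts G \<and>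
     (\<forall>i<length vs. \<forall>j<length vs. vs ! i \<rightarrow>\<^bsub>G\<^esub> vs ! j \<longleftrightarrow>
        j = Suc i mod length vs \<or> i = Suc j mod length vs)"

definition chordal :: "('a, 'b) pre_digraph \<Rightarrow> bool" where
  "chordal G \<longleftrightarrow> (\<nexists>vs. induced_cycle G vs \<and> 4 \<le> length vs)"

text \<open>
  The state of the game is the list of all moves so far, oldest first; a move is a vertex together
  with a color from \<^term>\<open>{..<n::nat}\<close>. No vertex is colored twice, so \<^const>\<open>map_of\<close> gives
  the current partial coloring.
\<close>

type_synonym 'a history = "('a \<times> nat) list"

definition has_mono_clique :: "('a, 'b) pre_digraph \<Rightarrow> nat \<Rightarrow> ('a \<rightharpoonup> nat) \<Rightarrow> bool" where
  "has_mono_clique G m c \<longleftrightarrow> (\<exists>K x. is_clique G K \<and> card K = m \<and> (\<forall>v\<in>K. c v = Some x))"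

definition legal_move ::
    "('a, 'b) pre_digraph \<Rightarrow> nat \<Rightarrow> nat \<Rightarrow> 'a history \<Rightarrow> 'a \<times> nat \<Rightarrow> bool" where
  "legal_move G k n h = (\<lambda>(v, x). v \<in> verts G \<and> map_of h v = None \<and> x < n \<and>
     \<not> has_mono_clique G (k + 1) ((map_of h)(v \<mapsto> x)))"

definition all_colored :: "('a, 'b) pre_digraph \<Rightarrow> 'a history \<Rightarrow> bool" where
  "all_colored G h \<longleftrightarrow> (\<forall>v\<in>verts G. map_of h v \<noteq> None)"

definition bob_has_won :: "('a, 'b) pre_digraph \<Rightarrow> nat \<Rightarrow> nat \<Rightarrow> 'a history \<Rightarrow> bool" where
  "bob_has_won G k n h \<longleftrightarrow>
     (\<exists>v\<in>verts G. map_of h v = None \<and> (\<forall>x<n. \<not> legal_move G k n h (v, x)))"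

definition game_over :: "('a, 'b) pre_digraph \<Rightarrow> nat \<Rightarrow> nat \<Rightarrow> 'a history \<Rightarrow> bool" where
  "game_over G k n h \<longleftrightarrow> all_colored G h \<or> bob_has_won G k n h"

text \<open>
  The histories that can arise when Alice, who moves first, follows the strategy \<open>\<sigma>\<close> and Bob
  makes arbitrary legal moves.
\<close>

inductive play :: "('a, 'b) pre_digraph \<Rightarrow> nat \<Rightarrow> nat \<Rightarrow> ('a history \<Rightarrow> 'a \<times> nat) \<Rightarrow> 'a history \<Rightarrow> bool"
  for G k n \<sigma> where
  start: "play G k n \<sigma> []"
| alice: "\<lbrakk>play G k n \<sigma> h; \<not> game_over G k n h; even (length h); legal_move G k n h (\<sigma> h)\<rbrakk>
    \<Longrightarrow> play G k n \<sigma> (h @ [\<sigma> h])"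
| bob: "\<lbrakk>play G k n \<sigma> h; \<not> game_over G k n h; odd (length h); legal_move G k n h m\<rbrakk>
    \<Longrightarrow> play G k n \<sigma> (h @ [m])"

text \<open>
  The first conjunct says that \<open>\<sigma>\<close> always supplies a legal move when it is Alice's turn. On a
  finite graph every play is finite, so the second says that Alice wins every play.
\<close>

definition winning_strategy ::
    "('a, 'b) pre_digraph \<Rightarrow> nat \<Rightarrow> nat \<Rightarrow> ('a history \<Rightarrow> 'a \<times> nat) \<Rightarrow> bool" where
  "winning_strategy G k n \<sigma> \<longleftrightarrow>
     (\<forall>h. play G k n \<sigma> h \<and> \<not> game_over G k n h \<and> even (length h) \<longrightarrow> legal_move G k n h (\<sigma> h)) \<and>
     (\<forall>h. play G k n \<sigma> h \<and> game_over G k n h \<longrightarrow> all_colored G h \<and> \<not> bob_has_won G k n h)"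

definition alice_wins :: "('a, 'b) pre_digraph \<Rightarrow> nat \<Rightarrow> nat \<Rightarrow> bool" where
  "alice_wins G k n \<longleftrightarrow> (\<exists>\<sigma>. winning_strategy G k n \<sigma>)"

definition game_chromatic_number :: "nat \<Rightarrow> ('a, 'b) pre_digraph \<Rightarrow> nat" where
  "game_chromatic_number k G = (LEAST n. alice_wins G k n)"

lemma play_invariant:
  assumes "play G k n \<sigma> h"
  shows "distinct (map fst h) \<and> fst ` set h \<subseteq> verts G \<and> \<not> has_mono_clique G (k + 1) (map_of h)"
  using assms
proof induction
  case start
  show ?case by (auto simp: has_mono_clique_def)
next
  have step: "distinct (map fst (h @ [m])) \<and> fst ` set (h @ [m]) \<subseteq> verts G \<and>
      \<not> has_mono_clique G (k + 1) (map_of (h @ [m]))"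
    if "distinct (map fst h) \<and> fst ` set h \<subseteq> verts G" "legal_move G k n h m" for h and m :: "'a \<times> nat"
  proof -
    obtain v x where m: "m = (v, x)" by (cases m)
    with that have v: "v \<in> verts G" "map_of h v = None"
      and mono: "\<not> has_mono_clique G (k + 1) ((map_of h)(v \<mapsto> x))"
      by (auto simp: legal_move_def)
    have "map_of (h @ [m]) = (map_of h)(v \<mapsto> x)"
      using v(2) m by (auto simp: map_add_def split: option.splits)
    with mono v that m show ?thesis by (auto simp: map_of_eq_None_iff)
  qed
  {
    case (alice h)
    with step show ?case by blast
  next
    case (bob h m)
    with step show ?case by blast
  }
qed

lemma ex_alice_wins:
  assumes "graph G" and "k \<ge> 1"
  shows "\<exists>n. alice_wins G k n"
proof -
  interpret graph G by fact
  let ?n = "card (verts G)"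
  have legal: "\<exists>x<?n. legal_move G k ?n h (v, x)"
    if h: "play G k ?n \<sigma> h" and v: "v \<in> verts G" "map_of h v = None" for \<sigma> h v
  proof -
    note inv = play_invariant[OF h]
    have "fst ` set h \<subset> verts G"
      using inv v by (auto simp: map_of_eq_None_iff)
    then have "card (fst ` set h) < ?n" by (simp add: psubset_card_mono)
    moreover have "card (fst ` set h) = length h"
      using inv by (metis distinct_card length_map set_map)
    moreover have "card (snd ` set h) \<le> length h"
      by (metis card_length length_map set_map)
    ultimately have "card (snd ` set h) < card {..<?n}" by simp
    then obtain x where x: "x < ?n" "x \<notin> snd ` set h"
      by (metis card_mono finite_imageI finite_set lessThan_iff not_le subsetI)
    have "\<not> has_mono_clique G (k + 1) ((map_of h)(v \<mapsto> x))"
    proof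
      assume "has_mono_clique G (k + 1) ((map_of h)(v \<mapsto> x))"
      then obtain K y where K: "is_clique G K" "card K = k + 1"
        and y: "\<forall>u\<in>K. ((map_of h)(v \<mapsto> x)) u = Some y"
        by (auto simp: has_mono_clique_def)
      show False
      proof (cases "v \<in> K")
        case True
        with y have "y = x" by auto
        with y x have "K \<subseteq> {v}" by (auto split: if_splits dest: map_of_SomeD) (metis image_eqI map_of_SomeD snd_conv)
        then have "card K \<le> 1" using card_mono[of "{v}" K] by simp
        with K assms show False by simp
      next
        case False
        with y have "\<forall>u\<in>K. map_of h u = Some y" by (metis fun_upd_other)
        with K inv show False unfolding has_mono_clique_def by blast
      qed
    qed
    with x v show ?thesis by (auto simp: legal_move_def)
  qed
  have not_bob: "\<not> bob_has_won G k ?n h" if "play G k ?n \<sigma> h" for \<sigma> h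
    using legal[OF that] by (auto simp: bob_has_won_def)
  define \<sigma> where "\<sigma> h = (SOME m. legal_move G k ?n h m)" for h
  have "legal_move G k ?n h (\<sigma> h)" if h: "play G k ?n \<sigma> h" and "\<not> game_over G k ?n h" for h
  proof -
    from that obtain v where "v \<in> verts G" "map_of h v = None"
      by (auto simp: game_over_def all_colored_def)
    with legal[OF h] show ?thesis unfolding \<sigma>_def by (metis someI)
  qed
  then have "winning_strategy G k ?n \<sigma>"
    using not_bob by (auto simp: winning_strategy_def game_over_def)
  then show ?thesis unfolding alice_wins_def by blast
qed

end

theory Submission
  imports Defs
begin

text \<open>
  A perfect elimination ordering gives every vertex at most two parents, i.e. earlier neighbors.
  Alice plays an activation strategy. A vertex colored by Bob chooses its earliest uncolored parent;
  a vertex chosen for the first time passes the choice on in the same way, and one that has already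
  passed it on, or that has no uncolored parent, is colored by Alice. She avoids the colors of its
  choosers and, while it has an uncolored parent, also the colors of its parents.

  A triangle at an uncolored vertex \<open>v\<close> consists of \<open>v\<close> and its two parents, or of \<open>v\<close>, a parent
  and a common child, or of \<open>v\<close> and two children, the later of which has chosen \<open>v\<close>. So a color that
  is lost for \<open>v\<close> is the color of a chooser or of a parent of \<open>v\<close>. There are at most two choosers,
  and if there are two, then one parent, namely the one chosen by \<open>v\<close> itself, does no harm; hence at
  most three of the four colors are lost.
\<close>

section \<open>Simplicial vertices of chordal graphs\<close>

context graph
begin

lemma not_adj_self: "\<not> u \<rightarrow>\<^bsub>G\<^esub> u"
  using adj_not_same by blast

lemma adj_sym: "u \<rightarrow>\<^bsub>G\<^esub> v \<longleftrightarrow> v \<rightarrow>\<^bsub>G\<^esub> u"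
  using sym_arcs by (auto simp: symmetric_def dest: symD)

text \<open>A walk along \<open>R\<close> of least length \<open>n\<close> is an induced path: a
  repeated vertex or a chord would allow a shortcut.\<close>

lemma ex_induced_path:
  assumes "R = (\<lambda>x y. x \<in> U \<and> y \<in> U \<and> x \<rightarrow>\<^bsub>G\<^esub> y)" and "R\<^sup>*\<^sup>* s t"
  obtains n f where "f 0 = s" "f n = t" "\<And>i. i < n \<Longrightarrow> f i \<in> U \<and> f (Suc i) \<in> U"
    "inj_on f {..n}"
    "\<And>i j. i \<le> n \<Longrightarrow> j \<le> n \<Longrightarrow> f i \<rightarrow>\<^bsub>G\<^esub> f j \<longleftrightarrow> j = Suc i \<or> i = Suc j"
proof -
  define n where "n = (LEAST n. (R ^^ n) s t)"
  have "(R ^^ n) s t" unfolding n_def using assms(2) by (metis LeastI rtranclp_imp_relpowp)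
  then obtain f where f: "f 0 = s" "f n = t" "\<And>i. i < n \<Longrightarrow> R (f i) (f (Suc i))"
    by (auto simp: relpowp_fun_conv)
  have n_le: "n \<le> m" if "(R ^^ m) s t" for m
    unfolding n_def using that by (rule Least_le)
  have upto: "(R ^^ i) s (f i)" if "i \<le> n" for i
    using that f by (auto simp: relpowp_fun_conv)
  have rest: "(R ^^ (n - i)) (f i) t" if "i \<le> n" for i
    unfolding relpowp_fun_conv using that f by (intro exI[of _ "\<lambda>k. f (i + k)"]) auto
  have "inj_on f {..n}"
  proof (rule linorder_inj_onI')
    fix i j assume ij: "i \<in> {..n}" "j \<in> {..n}" "i < j"
    show "f i \<noteq> f j"
    proof
      assume "f i = f j"
      then have "(R ^^ (i + (n - j))) s t"
        using upto[of i] rest[of j] ij unfolding relpowp_add by auto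
      then show False using n_le ij by fastforce
    qed
  qed
  moreover have chordless: "j \<le> Suc i" if "i \<le> n" "j \<le> n" "f i \<rightarrow>\<^bsub>G\<^esub> f j" for i j
  proof (rule ccontr)
    assume ij: "\<not> j \<le> Suc i"
    have "f i \<in> U" using f(3)[of i] ij that unfolding assms(1) by auto
    \<comment> \<open>Since \<open>j\<close> may equal \<open>n\<close>, membership is read off the
      step of the walk that enters \<open>f j\<close>.\<close>
    moreover have "f j \<in> U" using f(3)[of "j - 1"] ij that unfolding assms(1) by auto
    ultimately have "R (f i) (f j)" using that unfolding assms(1) by auto
    then have "(R ^^ Suc i) s (f j)" using upto[of i] that by auto
    then have "(R ^^ (Suc i + (n - j))) s t"
      using rest[of j] that unfolding relpowp_add by blast
    then show False using n_le[of "Suc i + (n - j)"] ij that by simp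
  qed
  moreover have "f i \<rightarrow>\<^bsub>G\<^esub> f j \<longleftrightarrow> j = Suc i \<or> i = Suc j" if "i \<le> n" "j \<le> n" for i j
  proof
    assume a: "f i \<rightarrow>\<^bsub>G\<^esub> f j"
    then have "i \<noteq> j" using not_adj_self by auto
    then show "j = Suc i \<or> i = Suc j"
      using chordless[OF that a] chordless[of j i] that a adj_sym by fastforce
  next
    assume "j = Suc i \<or> i = Suc j"
    then show "f i \<rightarrow>\<^bsub>G\<^esub> f j"
      using f(3)[of i] f(3)[of j] that adj_sym unfolding assms(1) by auto
  qed
  ultimately show ?thesis
    using that[of f n] f unfolding assms(1) by blast
qed

text \<open>The new vertex \<open>d\<close> sees only the two ends of the induced path, so no chord
  arises. The cycle has \<open>n + 2\<close> vertices, hence at least four.\<close>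

lemma induced_cycle_close_path:
  assumes inj: "inj_on f {..n}" and n: "2 \<le> n"
    and adj: "\<And>i j. i \<le> n \<Longrightarrow> j \<le> n \<Longrightarrow> f i \<rightarrow>\<^bsub>G\<^esub> f j \<longleftrightarrow> j = Suc i \<or> i = Suc j"
    and d: "d \<notin> f ` {..n}" "\<And>i. i \<le> n \<Longrightarrow> d \<rightarrow>\<^bsub>G\<^esub> f i \<longleftrightarrow> i = 0 \<or> i = n"
  shows "induced_cycle G (map f [0..<Suc n] @ [d])"
proof -
  define vs where "vs = map f [0..<Suc n] @ [d]"
  have len: "length vs = n + 2" unfolding vs_def by simp
  have nth: "vs ! i = (if i = Suc n then d else f i)" if "i < n + 2" for i
    using that unfolding vs_def by (auto simp: nth_append simp del: upt_Suc)
  have "distinct vs"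
    unfolding vs_def using inj d(1)
    by (auto simp: distinct_map inj_on_def atMost_def simp del: upt_Suc)
  moreover have "f i \<in> verts G" if "i \<le> n" for i
  proof (cases i)
    case 0
    then show ?thesis using adj[of 0 1] n adj_in_verts by force
  next
    case (Suc j)
    then show ?thesis using adj[of j i] that adj_in_verts by force
  qed
  moreover have "d \<in> verts G" using d(2)[of 0] adj_in_verts by blast
  moreover have "vs ! i \<rightarrow>\<^bsub>G\<^esub> vs ! j \<longleftrightarrow> j = Suc i mod (n + 2) \<or> i = Suc j mod (n + 2)"
    if "i < n + 2" "j < n + 2" for i j
  proof -
    \<comment> \<open>\<open>d\<close> sits at index \<open>Suc n\<close>, the only place where the
      successor wraps around.\<close>
    have "Suc k mod (n + 2) = (if k = Suc n then 0 else Suc k)" if "k < n + 2" for k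
      using that by auto
    moreover have "f i \<rightarrow>\<^bsub>G\<^esub> d \<longleftrightarrow> i = 0 \<or> i = n" if "i \<le> n" for i
      using d(2)[OF that] adj_sym by blast
    ultimately show ?thesis
      using that nth[OF that(1)] nth[OF that(2)] adj[of i j] d(2)[of i] d(2)[of j] not_adj_self[of d] n
      by (auto simp: less_Suc_eq_le)
  qed
  ultimately show ?thesis
    unfolding induced_cycle_def vs_def[symmetric] len
    using n by (auto simp: vs_def simp del: upt_Suc)
qed

text \<open>
  Take a connected set \<open>W\<close> of maximal size whose closed neighborhood is not everything. By
  maximality its boundary is completely joined to the rest \<open>D\<close>, so by chordality the boundary is a
  clique, and a simplicial vertex of \<open>D\<close> is simplicial in the whole graph.
\<close>

lemma ex_simplicial:
  assumes "chordal G" and "A \<subseteq> verts G" and "A \<noteq> {}"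
  shows "\<exists>v\<in>A. is_clique G {u \<in> A. u \<rightarrow>\<^bsub>G\<^esub> v}"
proof -
  have "finite A" using assms(2) finite_subset finite_verts by blast
  then show ?thesis using assms(2,3)
  proof (induction A rule: finite_psubset_induct)
    case (psubset A)
    show ?case
    proof (cases "is_clique G A")
      case True
      with psubset.prems show ?thesis unfolding is_clique_def by blast
    next
      case False
      then obtain a b where ab: "a \<in> A" "b \<in> A" "a \<noteq> b" "\<not> a \<rightarrow>\<^bsub>G\<^esub> b"
        using psubset.prems unfolding is_clique_def by blast
      \<comment> \<open>\<open>R W\<close> is adjacency inside \<open>W\<close>, \<open>S W\<close>
        is the boundary of \<open>W\<close> in \<open>A\<close>, and \<open>P W\<close> asks for a
        connected \<open>W\<close> that leaves some vertex of \<open>A\<close> outside its closed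
        neighborhood.\<close>
      define R where "R = (\<lambda>W x y. x \<in> W \<and> y \<in> W \<and> x \<rightarrow>\<^bsub>G\<^esub> y)"
      define S where "S = (\<lambda>W. {u \<in> A - W. \<exists>w\<in>W. w \<rightarrow>\<^bsub>G\<^esub> u})"
      define P where "P = (\<lambda>W. W \<noteq> {} \<and> W \<subseteq> A \<and> A - W - S W \<noteq> {} \<and> (\<forall>x\<in>W. \<forall>y\<in>W. (R W)\<^sup>*\<^sup>* x y))"
      \<comment> \<open>The vertex \<open>b\<close> stays outside the closed neighborhood of
        \<open>{a}\<close>.\<close>
      have "P {a}" unfolding P_def S_def using ab by auto
      moreover have "\<forall>W. P W \<longrightarrow> card W < Suc (card A)"
        unfolding P_def using psubset.hyps card_mono by (metis less_Suc_eq_le)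
      ultimately obtain W where W: "P W" and max: "\<And>W'. P W' \<Longrightarrow> card W' \<le> card W"
        using ex_has_greatest_nat[of P "{a}" card "Suc (card A)"] by (metis less_imp_le)
      define D where "D = A - W - S W"
      have WA: "W \<subseteq> A" "W \<noteq> {}" "D \<noteq> {}" and conn: "\<And>x y. x \<in> W \<Longrightarrow> y \<in> W \<Longrightarrow> (R W)\<^sup>*\<^sup>* x y"
        using W unfolding P_def D_def by auto
      have finW: "finite W" using WA psubset.hyps finite_subset by blast
      have mono: "(R U)\<^sup>*\<^sup>* x y" if "(R W)\<^sup>*\<^sup>* x y" "W \<subseteq> U" for U x y
        using that(1) by (rule mono_rtranclp[rule_format, rotated]) (use that(2) in \<open>auto simp: R_def\<close>)
      have joined: "s \<rightarrow>\<^bsub>G\<^esub> d" if s: "s \<in> S W" and d: "d \<in> D" for s d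
      proof (rule ccontr)
        assume nsd: "\<not> s \<rightarrow>\<^bsub>G\<^esub> d"
        obtain w where w: "w \<in> W" "w \<rightarrow>\<^bsub>G\<^esub> s" and sA: "s \<in> A" "s \<notin> W" using s unfolding S_def by auto
        \<comment> \<open>Adding \<open>s\<close> contradicts maximality: the larger set is
          connected through \<open>w\<close>, and \<open>d\<close> is still outside its closed
          neighborhood.\<close>
        let ?W = "insert s W"
        have to: "(R ?W)\<^sup>*\<^sup>* x s" if "x \<in> W" for x
        proof -
          have "(R ?W)\<^sup>*\<^sup>* x w" by (intro mono[OF conn] that w) blast
          moreover have "R ?W w s" using w unfolding R_def by auto
          ultimately show ?thesis by auto
        qed
        have fro: "(R ?W)\<^sup>*\<^sup>* s x" if "x \<in> W" for x
        proof -
          have "(R ?W)\<^sup>*\<^sup>* w x" by (intro mono[OF conn] that w) blast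
          moreover have "R ?W s w" using w adj_sym unfolding R_def by auto
          ultimately show ?thesis by (meson converse_rtranclp_into_rtranclp)
        qed
        have "(R ?W)\<^sup>*\<^sup>* x y" if "x \<in> ?W" "y \<in> ?W" for x y
          using that to fro mono[OF conn, of x y ?W] by auto
        moreover have "d \<in> A - ?W - S ?W"
          using d s nsd unfolding D_def S_def by auto
        ultimately have "P ?W" unfolding P_def using WA sA by blast
        then show False using max[of ?W] finW sA by simp
      qed
      have S_adj: "s \<rightarrow>\<^bsub>G\<^esub> t" if st: "s \<in> S W" "t \<in> S W" "s \<noteq> t" for s t
      proof (rule ccontr)
        assume nst: "\<not> s \<rightarrow>\<^bsub>G\<^esub> t"
        obtain d where d: "d \<in> D" using WA by auto
        obtain w w' where w: "w \<in> W" "w \<rightarrow>\<^bsub>G\<^esub> s" "w' \<in> W" "w' \<rightarrow>\<^bsub>G\<^esub> t" using st unfolding S_def by auto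
        let ?U = "insert s (insert t W)"
        \<comment> \<open>The walk goes from \<open>s\<close> to \<open>w\<close>, through the
          connected set \<open>W\<close> to \<open>w'\<close>, and on to \<open>t\<close>. A
          shortest one, closed by \<open>d\<close>, is the forbidden cycle.\<close>
        have "R ?U s w" "R ?U w' t" using w adj_sym unfolding R_def by auto
        moreover have "(R ?U)\<^sup>*\<^sup>* w w'" by (intro mono[OF conn] w) blast
        ultimately have path: "(R ?U)\<^sup>*\<^sup>* s t" by (meson converse_rtranclp_into_rtranclp rtranclp.rtrancl_into_rtrancl)
        have R_U: "R ?U = (\<lambda>x y. x \<in> ?U \<and> y \<in> ?U \<and> x \<rightarrow>\<^bsub>G\<^esub> y)" unfolding R_def ..
        obtain n f where f: "f 0 = s" "f n = t" "\<And>i. i < n \<Longrightarrow> f i \<in> ?U \<and> f (Suc i) \<in> ?U"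
          "inj_on f {..n}" "\<And>i j. i \<le> n \<Longrightarrow> j \<le> n \<Longrightarrow> f i \<rightarrow>\<^bsub>G\<^esub> f j \<longleftrightarrow> j = Suc i \<or> i = Suc j"
          using ex_induced_path[OF R_U path] by metis
        have "n \<noteq> 0" using f(1,2) st(3) by metis
        moreover have "n \<noteq> 1"
        proof
          assume "n = 1"
          then show False using f(5)[of 0 1] f(1,2) nst by simp
        qed
        ultimately have n2: "2 \<le> n" by simp
        have mem: "f i \<in> ?U" if "i \<le> n" for i
          using f(3)[of i] f(2) that by (cases "i = n") auto
        \<comment> \<open>By injectivity an inner vertex is neither \<open>s\<close> nor
          \<open>t\<close>, so it lies in \<open>W\<close>, where \<open>d\<close> has no
          neighbor.\<close>
        have int: "f i \<in> W" if "i \<le> n" "i \<noteq> 0" "i \<noteq> n" for i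
        proof -
          have "f i \<noteq> f 0" "f i \<noteq> f n" using f(4) that unfolding inj_on_def by auto
          then show ?thesis using mem[OF that(1)] f(1,2) by auto
        qed
        have "d \<notin> ?U" using d st unfolding D_def by auto
        then have "d \<notin> f ` {..n}" using mem by auto
        moreover have "d \<rightarrow>\<^bsub>G\<^esub> f i \<longleftrightarrow> i = 0 \<or> i = n" if "i \<le> n" for i
        proof (cases "i = 0 \<or> i = n")
          case True
          then show ?thesis using joined[OF st(1) d] joined[OF st(2) d] f(1,2) adj_sym by auto
        next
          case False
          then have "\<not> f i \<rightarrow>\<^bsub>G\<^esub> d" using int[OF that] d unfolding D_def S_def by auto
          then show ?thesis using False adj_sym by blast
        qed
        ultimately have "induced_cycle G (map f [0..<Suc n] @ [d])"
          using induced_cycle_close_path[OF f(4) n2 f(5)] by blast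
        moreover have "4 \<le> length (map f [0..<Suc n] @ [d])" using n2 by simp
        ultimately show False using assms(1) unfolding chordal_def by blast
      qed
      have DA: "D \<subset> A" "D \<subseteq> verts G" using WA psubset.prems unfolding D_def by auto
      obtain v where v: "v \<in> D" "is_clique G {u \<in> D. u \<rightarrow>\<^bsub>G\<^esub> v}"
        using psubset.IH[OF DA WA(3)] by blast
      \<comment> \<open>A vertex of \<open>D\<close> has no neighbor in \<open>W\<close>. So the
        neighbors of \<open>v\<close> come from a clique in \<open>D\<close> and from the clique
        \<open>S W\<close>, and these are completely joined.\<close>
      have nbr: "{u \<in> A. u \<rightarrow>\<^bsub>G\<^esub> v} \<subseteq> {u \<in> D. u \<rightarrow>\<^bsub>G\<^esub> v} \<union> S W"
        using v(1) unfolding D_def S_def by auto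
      have "is_clique G {u \<in> A. u \<rightarrow>\<^bsub>G\<^esub> v}"
        unfolding is_clique_def
      proof (intro conjI ballI impI)
        show "{u \<in> A. u \<rightarrow>\<^bsub>G\<^esub> v} \<subseteq> verts G" using psubset.prems by auto
        fix x y assume "x \<in> {u \<in> A. u \<rightarrow>\<^bsub>G\<^esub> v}" "y \<in> {u \<in> A. u \<rightarrow>\<^bsub>G\<^esub> v}" and "x \<noteq> y"
        then show "x \<rightarrow>\<^bsub>G\<^esub> y"
          using nbr v(2) joined S_adj adj_sym unfolding is_clique_def by (smt (verit) UnE mem_Collect_eq subsetD)
      qed
      then show ?thesis using v(1) DA by blast
    qed
  qed
qed

section \<open>Perfect elimination orderings\<close>

text \<open>Remove a simplicial vertex, rank the rest by induction, and put the removed vertex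
  last.\<close>

lemma ex_elimination_rank:
  assumes "chordal G" and "A \<subseteq> verts G"
  shows "\<exists>r :: 'a \<Rightarrow> nat. inj_on r A \<and> (\<forall>v\<in>A. is_clique G {u \<in> A. u \<rightarrow>\<^bsub>G\<^esub> v \<and> r u < r v})"
proof -
  have "finite A" using assms(2) finite_subset finite_verts by blast
  then show ?thesis using assms(2)
  proof (induction A rule: finite_psubset_induct)
    case (psubset A)
    show ?case
    proof (cases "A = {}")
      case False
      then obtain v where v: "v \<in> A" "is_clique G {u \<in> A. u \<rightarrow>\<^bsub>G\<^esub> v}"
        using ex_simplicial assms(1) psubset.prems by blast
      have "A - {v} \<subset> A" "A - {v} \<subseteq> verts G" using v psubset.prems by auto
      from psubset.IH[OF this] obtain r :: "'a \<Rightarrow> nat" where r: "inj_on r (A - {v})"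
        "\<And>w. w \<in> A - {v} \<Longrightarrow> is_clique G {u \<in> A - {v}. u \<rightarrow>\<^bsub>G\<^esub> w \<and> r u < r w}"
        by blast
      define m where "m = Suc (Max (insert 0 (r ` A)))"
      have m: "r u < m" if "u \<in> A" for u
        unfolding m_def using psubset.hyps that by (simp add: le_imp_less_Suc)
      let ?r = "r(v := m)"
      have "inj_on ?r A"
        using r(1) m by (auto simp: inj_on_def dest: less_imp_neq)
      moreover have "is_clique G {u \<in> A. u \<rightarrow>\<^bsub>G\<^esub> w \<and> ?r u < ?r w}" if w: "w \<in> A" for w
      proof (cases "w = v")
        case True
        then show ?thesis using v(2) unfolding is_clique_def by auto
      next
        case False
        \<comment> \<open>The vertex \<open>v\<close> has the top rank \<open>m\<close>, so it is
          not a lower neighbor of \<open>w\<close>.\<close>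
        then have "{u \<in> A. u \<rightarrow>\<^bsub>G\<^esub> w \<and> ?r u < ?r w} = {u \<in> A - {v}. u \<rightarrow>\<^bsub>G\<^esub> w \<and> r u < r w}"
          using m[OF w] by (auto split: if_splits)
        then show ?thesis using r(2)[of w] w False by simp
      qed
      ultimately show ?thesis by blast
    qed auto
  qed
qed

end

section \<open>The activation strategy\<close>

text \<open>This is a 2-degenerate graph with an injective ranking as witness; an elimination
  ordering of a chordal graph with clique number 3 is an instance.\<close>

locale ranked_graph = graph G for G :: "('a, 'b) pre_digraph" +
  fixes r :: "'a \<Rightarrow> nat"
  assumes inj_rank: "inj_on r (verts G)"
    and card_lower: "v \<in> verts G \<Longrightarrow> card {u \<in> verts G. u \<rightarrow>\<^bsub>G\<^esub> v \<and> r u < r v} \<le> 2"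
begin

definition parents :: "'a \<Rightarrow> 'a set" where
  "parents v = {u \<in> verts G. u \<rightarrow>\<^bsub>G\<^esub> v \<and> r u < r v}"

text \<open>The minimum is over all parents, colored or not, whereas a vertex chooses its earliest
  uncolored parent.\<close>

definition first_parent :: "'a \<Rightarrow> 'a \<Rightarrow> bool" where
  "first_parent x p \<longleftrightarrow> p \<in> parents x \<and> (\<forall>q\<in>parents x. r p \<le> r q)"

text \<open>\<open>a\<close> and \<open>b\<close> are the other corners of the triangle that color
  \<open>i\<close> at \<open>v\<close> would make monochromatic.\<close>

definition lost :: "('a \<rightharpoonup> nat) \<Rightarrow> 'a \<Rightarrow> nat \<Rightarrow> bool" where
  "lost c v i \<longleftrightarrow>
     (\<exists>a b. v \<rightarrow>\<^bsub>G\<^esub> a \<and> v \<rightarrow>\<^bsub>G\<^esub> b \<and> a \<rightarrow>\<^bsub>G\<^esub> b \<and> c a = Some i \<and> c b = Some i)"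

text \<open>
  A pair \<open>(x, v)\<close> in the bookkeeping relation \<open>C\<close> means that \<open>x\<close> has chosen its parent \<open>v\<close> as the
  next vertex for Alice to take care of.
\<close>

definition choosers :: "('a \<times> 'a) set \<Rightarrow> 'a \<Rightarrow> 'a set" where
  "choosers C v = {x. (x, v) \<in> C}"

definition chooser_colors :: "('a \<rightharpoonup> nat) \<Rightarrow> ('a \<times> 'a) set \<Rightarrow> 'a \<Rightarrow> nat set" where
  "chooser_colors c C v = {i. \<exists>x\<in>choosers C v. c x = Some i}"

text \<open>
  The last clause is what makes a parent chosen by \<open>v\<close> harmless: choosers of \<open>v\<close> aside, at most
  one color is then lost for \<open>v\<close>.
\<close>

definition consistent :: "('a \<rightharpoonup> nat) \<Rightarrow> ('a \<times> 'a) set \<Rightarrow> bool" where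
  "consistent c C \<longleftrightarrow>
     (\<forall>x v. (x, v) \<in> C \<longrightarrow> v \<in> parents x) \<and>
     (\<forall>x p. c x \<noteq> None \<and> c p = None \<and> first_parent x p \<longrightarrow> (x, p) \<in> C) \<and>
     (\<forall>v p x. (v, p) \<in> C \<and> c v = None \<and> c p \<noteq> None \<and> c x = c p \<and> v \<in> parents x \<and> p \<in> parents x
        \<longrightarrow> (x, v) \<in> C)"

text \<open>The first conjunct supplies the harmless parent in \<open>ex_good_color\<close>; the
  second preserves the second clause of \<open>consistent\<close> when \<open>v\<close> gets
  colored.\<close>

definition settled :: "('a \<rightharpoonup> nat) \<Rightarrow> ('a \<times> 'a) set \<Rightarrow> 'a \<Rightarrow> bool" where
  "settled c C v \<longleftrightarrow> (\<exists>p. (v, p) \<in> C) \<and> (\<forall>p. first_parent v p \<and> c p = None \<longrightarrow> (v, p) \<in> C)"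

text \<open>The state in which Alice may leave an uncolored vertex: it can bear one more chooser and
  is then still savable.\<close>

definition quiet :: "('a \<rightharpoonup> nat) \<Rightarrow> ('a \<times> 'a) set \<Rightarrow> 'a \<Rightarrow> bool" where
  "quiet c C v \<longleftrightarrow> card (choosers C v) \<le> 1 \<and> (choosers C v \<noteq> {} \<longrightarrow> settled c C v)"

text \<open>In these two situations at most three colors have to be avoided at
  \<open>v\<close>.\<close>

definition savable :: "('a \<rightharpoonup> nat) \<Rightarrow> ('a \<times> 'a) set \<Rightarrow> 'a \<Rightarrow> bool" where
  "savable c C v \<longleftrightarrow> card (choosers C v) \<le> 1 \<or> card (choosers C v) \<le> 2 \<and> settled c C v"

definition stable :: "('a \<rightharpoonup> nat) \<Rightarrow> ('a \<times> 'a) set \<Rightarrow> bool" where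
  "stable c C \<longleftrightarrow> consistent c C \<and> (\<forall>v\<in>verts G. c v = None \<longrightarrow> quiet c C v)"

text \<open>\<open>u\<close> is the vertex that Alice has to take care of next; a second chooser is
  tolerated only there.\<close>

definition stable_except :: "('a \<rightharpoonup> nat) \<Rightarrow> ('a \<times> 'a) set \<Rightarrow> 'a \<Rightarrow> bool" where
  "stable_except c C u \<longleftrightarrow> consistent c C \<and> u \<in> verts G \<and> c u = None \<and> savable c C u \<and>
     (\<forall>v\<in>verts G. c v = None \<and> v \<noteq> u \<longrightarrow> quiet c C v)"

lemma parents_subset: "parents v \<subseteq> verts G"
  unfolding parents_def by auto

lemma finite_parents [simp]: "finite (parents v)"
  using parents_subset finite_subset finite_verts by blast

lemma parent_child_in_verts: "p \<in> parents v \<Longrightarrow> p \<in> verts G \<and> v \<in> verts G"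
  unfolding parents_def using adj_in_verts by blast

lemma card_parents: "card (parents v) \<le> 2"
proof (cases "v \<in> verts G")
  case True
  then show ?thesis using card_lower unfolding parents_def by blast
next
  case False
  then have "parents v = {}" using parent_child_in_verts by blast
  then show ?thesis by simp
qed

lemma rank_eq: "u \<in> verts G \<Longrightarrow> v \<in> verts G \<Longrightarrow> r u = r v \<Longrightarrow> u = v"
  using inj_rank unfolding inj_on_def by blast

lemma parents_eq_pair:
  assumes "p \<in> parents x" "q \<in> parents x" "p \<noteq> q"
  shows "parents x = {p, q}"
proof -
  have "{p, q} \<subseteq> parents x" "card {p, q} = 2" using assms by auto
  then show ?thesis using card_parents[of x] card_seteq[of "parents x" "{p, q}"] by simp
qed

text \<open>The bound of two leaves only \<open>p\<close> and \<open>v\<close> as parents of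
  \<open>x\<close>, and \<open>p\<close> precedes \<open>v\<close>.\<close>

lemma first_parent_grandparent:
  assumes "p \<in> parents x" "v \<in> parents x" "p \<in> parents v"
  shows "first_parent x p"
proof -
  have "r p < r v" using assms(3) unfolding parents_def by auto
  then have "parents x = {p, v}" using parents_eq_pair assms by blast
  then show ?thesis using \<open>r p < r v\<close> unfolding first_parent_def by auto
qed

lemma ex_first_uncolored_parent:
  assumes "p \<in> parents x" "c p = None"
  obtains u where "u \<in> parents x" "c u = None" "\<And>q. q \<in> parents x \<Longrightarrow> c q = None \<Longrightarrow> r u \<le> r q"
  using ex_has_least_nat[of "\<lambda>u. u \<in> parents x \<and> c u = None" p r] assms by blast

lemma consistent_parent: "consistent c C \<Longrightarrow> (x, v) \<in> C \<Longrightarrow> v \<in> parents x"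
  unfolding consistent_def by blast

lemma consistent_first_parent:
  "consistent c C \<Longrightarrow> c x \<noteq> None \<Longrightarrow> c p = None \<Longrightarrow> first_parent x p \<Longrightarrow> (x, p) \<in> C"
  unfolding consistent_def by blast

lemma consistent_mono_edge:
  "consistent c C \<Longrightarrow> (v, p) \<in> C \<Longrightarrow> c v = None \<Longrightarrow> c p \<noteq> None \<Longrightarrow> c x = c p
    \<Longrightarrow> v \<in> parents x \<Longrightarrow> p \<in> parents x \<Longrightarrow> (x, v) \<in> C"
  unfolding consistent_def by blast

text \<open>Guards against the default value 0 of \<open>card\<close> on infinite sets in
  \<open>quiet\<close> and \<open>savable\<close>.\<close>

lemma finite_choosers:
  assumes "consistent c C"
  shows "finite (choosers C v)"
proof -
  have "choosers C v \<subseteq> verts G"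
    using assms parent_child_in_verts unfolding consistent_def choosers_def by blast
  then show ?thesis using finite_subset finite_verts by blast
qed

lemma finite_card_colors:
  assumes "finite X"
  shows "finite {i. \<exists>x\<in>X. c x = Some i}" "card {i. \<exists>x\<in>X. c x = Some i} \<le> card X"
proof -
  have sub: "{i. \<exists>x\<in>X. c x = Some i} \<subseteq> (\<lambda>x. the (c x)) ` X" by force
  then show "finite {i. \<exists>x\<in>X. c x = Some i}" using assms finite_subset by blast
  show "card {i. \<exists>x\<in>X. c x = Some i} \<le> card X"
    using card_mono[OF _ sub] card_image_le[OF assms, of "\<lambda>x. the (c x)"] assms by simp
qed

section \<open>Counting the lost colors\<close>

lemma lost_cases:
  assumes con: "consistent c C" and v: "c v = None" and l: "lost c v i"
  shows "i \<in> chooser_colors c C v \<or>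
    (\<exists>p\<in>parents v. c p = Some i \<and>
      ((\<exists>q\<in>parents v. q \<noteq> p \<and> c q = Some i) \<or>
       (\<exists>x. v \<in> parents x \<and> p \<in> parents x \<and> c x = Some i \<and> (x, v) \<notin> C)))"
proof -
  \<comment> \<open>By symmetry \<open>a\<close> precedes \<open>b\<close>; the cases are the
    positions of \<open>v\<close> in the rank order of the triangle.\<close>
  have *: ?thesis if a: "v \<rightarrow>\<^bsub>G\<^esub> a" "v \<rightarrow>\<^bsub>G\<^esub> b" "a \<rightarrow>\<^bsub>G\<^esub> b" "c a = Some i" "c b = Some i" "r a < r b" for a b
  proof -
    have V: "v \<in> verts G" "a \<in> verts G" "b \<in> verts G" using a adj_in_verts by blast+
    have "v \<noteq> a" "v \<noteq> b" using a not_adj_self by auto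
    then have "r v \<noteq> r a" "r v \<noteq> r b" using rank_eq V by blast+
    then consider "r b < r v" | "r a < r v" "r v < r b" | "r v < r a" using a(6) by linarith
    then show ?thesis
    proof cases
      case 1
      then have "a \<in> parents v" "b \<in> parents v" "b \<noteq> a" using a V adj_sym unfolding parents_def by auto
      then show ?thesis using a by blast
    next
      case 2
      then have "a \<in> parents v" "v \<in> parents b" "a \<in> parents b" using a V adj_sym unfolding parents_def by auto
      \<comment> \<open>Either \<open>b\<close> has chosen \<open>v\<close>, and \<open>i\<close> is
        a chooser color, or \<open>b\<close> witnesses the last alternative.\<close>
      then show ?thesis using a unfolding chooser_colors_def choosers_def by blast
    next
      case 3
      then have "v \<in> parents a" "v \<in> parents b" "a \<in> parents b" using a V adj_sym unfolding parents_def by auto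
      \<comment> \<open>The parents of \<open>b\<close> are \<open>v\<close> and \<open>a\<close>,
        and \<open>v\<close> comes first, so \<open>consistent\<close> makes \<open>b\<close> a
        chooser of \<open>v\<close>.\<close>
      then have "first_parent b v" using first_parent_grandparent by blast
      then have "(b, v) \<in> C" using con v a unfolding consistent_def by blast
      then show ?thesis using a unfolding chooser_colors_def choosers_def by blast
    qed
  qed
  from l obtain a b where ab: "v \<rightarrow>\<^bsub>G\<^esub> a" "v \<rightarrow>\<^bsub>G\<^esub> b" "a \<rightarrow>\<^bsub>G\<^esub> b" "c a = Some i" "c b = Some i"
    unfolding lost_def by blast
  then have "a \<noteq> b" using not_adj_self by auto
  then have "r a \<noteq> r b" using rank_eq ab adj_in_verts by blast
  then consider "r a < r b" | "r b < r a" by linarith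
  then show ?thesis
    using *[OF ab] *[OF ab(2,1) _ ab(5,4)] ab(3) adj_sym[of a b] by cases auto
qed

text \<open>A pigeonhole argument. The last conjunct serves to preserve the third clause of
  \<open>consistent\<close> once \<open>v\<close> has color \<open>i\<close>.\<close>

lemma ex_good_color:
  assumes con: "consistent c C" and v: "c v = None" and sav: "savable c C v"
  shows "\<exists>i<4. i \<notin> chooser_colors c C v \<and> \<not> lost c v i \<and>
    ((\<exists>q\<in>parents v. c q = None) \<longrightarrow> (\<forall>p\<in>parents v. c p \<noteq> Some i))"
proof -
  \<comment> \<open>The colors to avoid are those of the choosers and of a set \<open>P\<close> of
    parents; if the two sets have at most three members in all, one of the four colors is
    free.\<close>
  define B where "B = (\<lambda>P. chooser_colors c C v \<union> {i. \<exists>x\<in>P. c x = Some i})"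
  have fin: "finite (choosers C v)" using finite_choosers con by blast
  have pick: "\<exists>i<4. i \<notin> B P" if "finite P" "card (choosers C v) + card P \<le> 3" for P
  proof -
    have "finite (B P)" unfolding B_def chooser_colors_def using finite_card_colors fin that by blast
    moreover have "card (B P) \<le> card (choosers C v) + card P"
      unfolding B_def chooser_colors_def
      using card_Un_le finite_card_colors(2)[OF fin, of c] finite_card_colors(2)[OF that(1), of c]
      by (meson add_mono order_trans)
    ultimately have "\<not> {..<4} \<subseteq> B P" using that(2) card_mono[of "B P" "{..<4::nat}"] by auto
    then show ?thesis by auto
  qed
  have all: "i \<notin> chooser_colors c C v \<and> \<not> lost c v i \<and> (\<forall>p\<in>parents v. c p \<noteq> Some i)"
    if "i \<notin> B {p \<in> parents v. c p \<noteq> None}" for i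
    using that lost_cases[OF con v, of i] unfolding B_def by fastforce
  show ?thesis
  proof (cases "card (choosers C v) \<le> 1")
    case True
    have "card {p \<in> parents v. c p \<noteq> None} \<le> 2"
      using card_parents[of v] card_mono[of "parents v" "{p \<in> parents v. c p \<noteq> None}"] by simp
    then have "\<exists>i<4. i \<notin> B {p \<in> parents v. c p \<noteq> None}" using True by (intro pick) auto
    then show ?thesis using all by blast
  next
    case False
    then have two: "card (choosers C v) \<le> 2" and "settled c C v" using sav unfolding savable_def by auto
    then obtain p where p: "(v, p) \<in> C" unfolding settled_def by blast
    then have pv: "p \<in> parents v" using con unfolding consistent_def by blast
    have one: "card (parents v - {q}) \<le> 1" if "q \<in> parents v" for q
      using card_parents[of v] that by simp
    show ?thesis
    proof (cases "\<exists>q\<in>parents v. c q = None")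
      case True
      then obtain q where q: "q \<in> parents v" "c q = None" by blast
      \<comment> \<open>The uncolored parent \<open>q\<close> costs no color, so at most two
        choosers and one parent count.\<close>
      have "card {p \<in> parents v. c p \<noteq> None} \<le> card (parents v - {q})"
        using q by (intro card_mono) auto
      then have "\<exists>i<4. i \<notin> B {p \<in> parents v. c p \<noteq> None}"
        using two one[OF q(1)] by (intro pick) auto
      then show ?thesis using all by blast
    next
      case False
      \<comment> \<open>The parent \<open>p\<close> chosen by \<open>v\<close> is not counted.
        Losing \<open>i\<close> would require a child of \<open>v\<close> and \<open>p\<close> that
        shares the color of \<open>p\<close> but has not chosen \<open>v\<close>, against the third
        clause of \<open>consistent\<close>.\<close>
      have "\<exists>i<4. i \<notin> B (parents v - {p})" using two one[OF pv] by (intro pick) auto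
      then obtain i where i: "i < 4" "i \<notin> B (parents v - {p})" by blast
      have "\<not> lost c v i"
      proof
        assume "lost c v i"
        then obtain q where q: "q \<in> parents v" "c q = Some i"
            "(\<exists>q'\<in>parents v. q' \<noteq> q \<and> c q' = Some i) \<or>
             (\<exists>x. v \<in> parents x \<and> q \<in> parents x \<and> c x = Some i \<and> (x, v) \<notin> C)"
          using lost_cases[OF con v, of i] i(2) unfolding B_def by blast
        have "q = p" using q i(2) unfolding B_def by blast
        moreover have "\<not> (\<exists>q'\<in>parents v. q' \<noteq> p \<and> c q' = Some i)"
          using i(2) unfolding B_def by blast
        ultimately obtain x where "v \<in> parents x" "p \<in> parents x" "c x = c p" "(x, v) \<notin> C" "c p \<noteq> None"
          using q by auto
        then show False using con p v unfolding consistent_def by blast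
      qed
      then show ?thesis using i False unfolding B_def by blast
    qed
  qed
qed

section \<open>Alice's move\<close>

lemma quiet_savable: "quiet c C v \<Longrightarrow> savable c C v"
  unfolding quiet_def savable_def by blast

lemma settled_mono:
  "settled c C v \<Longrightarrow> dom c \<subseteq> dom c' \<Longrightarrow> C \<subseteq> C' \<Longrightarrow> settled c' C' v"
  unfolding settled_def by (blast dest: subsetD)

lemma quiet_mono:
  "quiet c C v \<Longrightarrow> dom c \<subseteq> dom c' \<Longrightarrow> C \<subseteq> C' \<Longrightarrow> choosers C' v = choosers C v
    \<Longrightarrow> quiet c' C' v"
  unfolding quiet_def using settled_mono[of c C v c' C'] by simp

text \<open>The color is that of \<open>ex_good_color\<close>. The second hypothesis secures the
  second clause of \<open>consistent\<close> for the newly colored \<open>u\<close>.\<close>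

lemma ex_stabilizing_color:
  assumes ex: "stable_except c C u" and u: "settled c C u \<or> (\<forall>p\<in>parents u. c p \<noteq> None)"
  shows "\<exists>i<4. \<not> lost c u i \<and> stable (c(u \<mapsto> i)) C"
proof -
  have con: "consistent c C" and cu: "c u = None" and sav: "savable c C u"
    and quiet: "\<And>v. v \<in> verts G \<Longrightarrow> c v = None \<Longrightarrow> v \<noteq> u \<Longrightarrow> quiet c C v"
    using ex unfolding stable_except_def by blast+
  obtain i where i: "i < 4" "i \<notin> chooser_colors c C u" "\<not> lost c u i"
    "\<And>q p. q \<in> parents u \<Longrightarrow> c q = None \<Longrightarrow> p \<in> parents u \<Longrightarrow> c p \<noteq> Some i"
    using ex_good_color[OF con cu sav] by blast
  let ?c = "c(u \<mapsto> i)"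
  note parC = consistent_parent[OF con]
  have "consistent ?c C"
    unfolding consistent_def
  proof (intro conjI allI impI)
    fix x p assume "?c x \<noteq> None \<and> ?c p = None \<and> first_parent x p"
    then have xp: "?c x \<noteq> None" "c p = None" "first_parent x p" by (auto split: if_splits)
    show "(x, p) \<in> C"
    proof (cases "x = u")
      case True
      then have "settled c C u" using u xp unfolding first_parent_def by blast
      then show ?thesis using True xp unfolding settled_def by blast
    next
      case False
      then show ?thesis using xp consistent_first_parent[OF con, of x p] by simp
    qed
  next
    fix v p x
    assume "(v, p) \<in> C \<and> ?c v = None \<and> ?c p \<noteq> None \<and> ?c x = ?c p \<and> v \<in> parents x \<and> p \<in> parents x"
    then have h: "(v, p) \<in> C" "v \<noteq> u" "c v = None" "?c p \<noteq> None" "?c x = ?c p" "v \<in> parents x" "p \<in> parents x"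
      by (auto split: if_splits)
    have px: "p \<noteq> x" using h unfolding parents_def by auto
    show "(x, v) \<in> C"
    proof (cases "p = u")
      case True
      then have cx: "c x = Some i" using h px by auto
      \<comment> \<open>So \<open>x\<close> would be a chooser of \<open>u\<close> with color
        \<open>i\<close>, and chooser colors were avoided.\<close>
      have "first_parent x u" using first_parent_grandparent h parC True by blast
      then have "(x, u) \<in> C" using consistent_first_parent[OF con] cx cu by simp
      then have False using i(2) cx unfolding chooser_colors_def choosers_def by blast
      then show ?thesis ..
    next
      case pu: False
      show ?thesis
      proof (cases "x = u")
        case True
        \<comment> \<open>\<open>v\<close> is an uncolored parent of \<open>u\<close>, so
          \<open>i\<close> also avoids the color of the parent \<open>p\<close>.\<close>
        then show ?thesis using h(3,5-7) pu i(4)[of v p] by simp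
      next
        case False
        then show ?thesis using h pu consistent_mono_edge[OF con, of v p x] by simp
      qed
    qed
  qed (use parC in auto)
  moreover have "quiet ?c C v" if "v \<in> verts G" "?c v = None" for v
    using that quiet[of v] quiet_mono[of c C v ?c C] by (auto split: if_splits)
  ultimately have "stable ?c C" unfolding stable_def by blast
  then show ?thesis using i by blast
qed

text \<open>Induction on the rank of \<open>u\<close>: either \<open>u\<close> can be colored at
  once, or it chooses its earliest uncolored parent, which has lower rank and becomes the
  exceptional vertex.\<close>

lemma stable_except_reply:
  "stable_except c C u \<Longrightarrow>
    \<exists>z\<in>verts G. \<exists>i<4. \<exists>C'. c z = None \<and> \<not> lost c z i \<and> stable (c(z \<mapsto> i)) C'"
proof (induction "r u" arbitrary: u C rule: less_induct)
  case less
  have con: "consistent c C" and uV: "u \<in> verts G" and cu: "c u = None" and sav: "savable c C u"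
    and quiet: "\<And>v. v \<in> verts G \<Longrightarrow> c v = None \<Longrightarrow> v \<noteq> u \<Longrightarrow> quiet c C v"
    using less.prems unfolding stable_except_def by blast+
  show ?case
  proof (cases "settled c C u \<or> (\<forall>p\<in>parents u. c p \<noteq> None)")
    case True
    then show ?thesis using ex_stabilizing_color[OF less.prems] uV cu by blast
  next
    case False
    then obtain w where w: "w \<in> parents u" "c w = None"
        "\<And>q. q \<in> parents u \<Longrightarrow> c q = None \<Longrightarrow> r w \<le> r q"
      using ex_first_uncolored_parent[of _ u c] by blast
    have wu: "r w < r u" "w \<noteq> u" "w \<in> verts G" using w(1) unfolding parents_def by auto
    let ?C = "insert (u, w) C"
    have ch: "choosers ?C w = insert u (choosers C w)"
      and ch': "\<And>v. v \<noteq> w \<Longrightarrow> choosers ?C v = choosers C v"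
      unfolding choosers_def by auto
    have card1: "card (choosers C u) \<le> 1" using False sav unfolding savable_def by blast
    have "consistent c ?C"
      unfolding consistent_def
    proof (intro conjI allI impI)
      fix x v assume "(x, v) \<in> ?C"
      then show "v \<in> parents x" using consistent_parent[OF con] w(1) by blast
    next
      fix x p assume "c x \<noteq> None \<and> c p = None \<and> first_parent x p"
      then show "(x, p) \<in> ?C" using consistent_first_parent[OF con] by blast
    next
      fix v p x
      assume h: "(v, p) \<in> ?C \<and> c v = None \<and> c p \<noteq> None \<and> c x = c p \<and> v \<in> parents x \<and> p \<in> parents x"
      \<comment> \<open>The pair cannot be the new one, because \<open>w\<close> is
        uncolored.\<close>
      then have "(v, p) \<in> C" using w(2) by auto
      then show "(x, v) \<in> ?C" using consistent_mono_edge[OF con] h by blast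
    qed
    moreover have "savable c ?C w"
    proof (cases "choosers C w = {}")
      case True
      then show ?thesis unfolding savable_def ch by simp
    next
      case False
      \<comment> \<open>A vertex that already had a chooser was quiet, hence settled, and so bears
        the second chooser \<open>u\<close>.\<close>
      then have "settled c C w" "card (choosers C w) \<le> 1"
        using quiet[of w] wu w unfolding quiet_def by blast+
      then show ?thesis
        unfolding savable_def ch using settled_mono[of c C w c ?C]
        by (auto simp: card_insert_if finite_choosers[OF con])
    qed
    moreover have "quiet c ?C v" if v: "v \<in> verts G" "c v = None" "v \<noteq> w" for v
    proof (cases "v = u")
      case True
      \<comment> \<open>If the first parent of \<open>u\<close> is uncolored, it is also the
        earliest uncolored one, namely \<open>w\<close>; so \<open>u\<close> is now settled.\<close>
      have "(u, p) \<in> ?C" if "first_parent u p" "c p = None" for p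
      proof -
        have "p \<in> parents u" "r p \<le> r w" using that w(1) unfolding first_parent_def by auto
        then have "p = w" using w(3)[of p] that(2) rank_eq wu(3) parents_subset
          by (meson order_antisym subsetD)
        then show ?thesis by simp
      qed
      then have "settled c ?C u" unfolding settled_def by blast
      then show ?thesis using True card1 ch' v unfolding quiet_def by simp
    next
      case False
      then show ?thesis using quiet[of v] v ch' quiet_mono[of c C v c ?C] by auto
    qed
    ultimately have "stable_except c ?C w" unfolding stable_except_def using wu w by blast
    then show ?thesis using less.hyps wu by blast
  qed
qed

text \<open>Any uncolored vertex may play the exceptional one. This covers the opening move and
  moves of Bob that leave the position stable.\<close>

lemma stable_reply:
  assumes "stable c C" and z: "z \<in> verts G" "c z = None"
  shows "\<exists>z\<in>verts G. \<exists>i<4. \<exists>C'. c z = None \<and> \<not> lost c z i \<and> stable (c(z \<mapsto> i)) C'"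
proof -
  have "stable_except c C z"
    using assms quiet_savable unfolding stable_def stable_except_def by blast
  then show ?thesis by (rule stable_except_reply)
qed

section \<open>Bob's move\<close>

text \<open>The color \<open>i\<close> is arbitrary, so the third clause of
  \<open>consistent\<close> must be saved by the choosers. If \<open>x\<close> has an uncolored
  parent, it chooses the earliest one, which becomes exceptional.\<close>

lemma stable_after_bob_move:
  assumes st: "stable c C" and x: "x \<in> verts G" "c x = None"
  shows "stable (c(x \<mapsto> i)) C \<or> (\<exists>C' u. stable_except (c(x \<mapsto> i)) C' u)"
proof -
  let ?c = "c(x \<mapsto> i)"
  have con: "consistent c C" and quiet: "\<And>v. v \<in> verts G \<Longrightarrow> c v = None \<Longrightarrow> quiet c C v"
    using st unfolding stable_def by blast+
  note parC = consistent_parent[OF con]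
  \<comment> \<open>\<open>L\<close> and \<open>K\<close> are the second and third clauses of
    \<open>consistent\<close> for vertices other than \<open>x\<close>; no new pair is needed for
    them.\<close>
  have L: "(y, p) \<in> C" if "y \<noteq> x" "?c y \<noteq> None" "?c p = None" "first_parent y p" for y p
    using that consistent_first_parent[OF con, of y p] by (simp split: if_splits)
  have K: "(y, v) \<in> C" if "y \<noteq> x" "(v, p) \<in> C" "?c v = None" "?c p \<noteq> None" "?c y = ?c p"
    "v \<in> parents y" "p \<in> parents y" for v p y
  proof (cases "p = x")
    case True
    have "c y \<noteq> None" using that by auto
    have "first_parent y x" using first_parent_grandparent that parC True by blast
    then have "(y, x) \<in> C" using \<open>c y \<noteq> None\<close> consistent_first_parent[OF con] x by blast
    \<comment> \<open>Two choosers of \<open>x\<close> are impossible, since \<open>x\<close> was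
      quiet before the move.\<close>
    then have "{v, y} \<subseteq> choosers C x" using that True unfolding choosers_def by auto
    moreover have "v \<noteq> y" using that unfolding parents_def by auto
    ultimately have "2 \<le> card (choosers C x)"
      using card_mono[OF finite_choosers[OF con], of "{v, y}" x] by simp
    then have False using quiet[OF x] unfolding quiet_def by simp
    then show ?thesis ..
  next
    case False
    then show ?thesis using that consistent_mono_edge[OF con, of v p y] by (simp split: if_splits)
  qed
  show ?thesis
  proof (cases "\<forall>p\<in>parents x. c p \<noteq> None")
    case True
    have "consistent ?c C"
      unfolding consistent_def
    proof (intro conjI allI impI)
      fix y p assume h: "?c y \<noteq> None \<and> ?c p = None \<and> first_parent y p"
      then have "c p = None" "p \<in> parents y" unfolding first_parent_def by (auto split: if_splits)
      then have "y \<noteq> x" using True by blast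
      then show "(y, p) \<in> C" using L h by blast
    next
      fix v p y
      assume h: "(v, p) \<in> C \<and> ?c v = None \<and> ?c p \<noteq> None \<and> ?c y = ?c p \<and> v \<in> parents y \<and> p \<in> parents y"
      then have "c v = None" by (auto split: if_splits)
      then have "y \<noteq> x" using True h by blast
      then show "(y, v) \<in> C" using K h by blast
    qed (use parC in auto)
    moreover have "quiet ?c C v" if "v \<in> verts G" "?c v = None" for v
      using that quiet[of v] quiet_mono[of c C v ?c C] by (auto split: if_splits)
    ultimately show ?thesis unfolding stable_def by blast
  next
    case False
    then obtain u where u: "u \<in> parents x" "c u = None"
        "\<And>q. q \<in> parents x \<Longrightarrow> c q = None \<Longrightarrow> r u \<le> r q"
      using ex_first_uncolored_parent[of _ x c] by blast
    have ux: "u \<noteq> x" "u \<in> verts G" using u(1) unfolding parents_def by auto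
    let ?C = "insert (x, u) C"
    have ch: "choosers ?C u = insert x (choosers C u)"
      and ch': "\<And>v. v \<noteq> u \<Longrightarrow> choosers ?C v = choosers C v"
      unfolding choosers_def by auto
    have "consistent ?c ?C"
      unfolding consistent_def
    proof (intro conjI allI impI)
      fix y v assume "(y, v) \<in> ?C"
      then show "v \<in> parents y" using parC u by auto
    next
      fix y p assume h: "?c y \<noteq> None \<and> ?c p = None \<and> first_parent y p"
      show "(y, p) \<in> ?C"
      proof (cases "y = x")
        case True
        then have "p \<in> parents x" "r p \<le> r u" "c p = None"
          using h u(1) unfolding first_parent_def by (auto split: if_splits)
        then have "p = u" using u(3)[of p] rank_eq ux parents_subset
          by (meson order_antisym subsetD)
        then show ?thesis using True by simp
      next
        case False
        then show ?thesis using L h by blast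
      qed
    next
      fix v p y
      assume h: "(v, p) \<in> ?C \<and> ?c v = None \<and> ?c p \<noteq> None \<and> ?c y = ?c p \<and> v \<in> parents y \<and> p \<in> parents y"
      then have vp: "(v, p) \<in> C" and cv: "c v = None" by (auto split: if_splits)
      show "(y, v) \<in> ?C"
      proof (cases "y = x")
        case True
        then have "p \<in> parents x" "v \<in> parents x" "p \<noteq> x" using h unfolding parents_def by auto
        then have "c p \<noteq> None" "p \<noteq> v" using h cv by (auto split: if_splits)
        \<comment> \<open>Of the only two parents \<open>p\<close> is colored, so the parent just
          chosen by \<open>x\<close> is \<open>v\<close>.\<close>
        then have "parents x = {p, v}" using parents_eq_pair \<open>p \<in> parents x\<close> \<open>v \<in> parents x\<close> by blast
        then have "u = v" using u \<open>c p \<noteq> None\<close> by auto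
        then show ?thesis using True by simp
      next
        case False
        from h have h': "?c v = None" "?c p \<noteq> None" "?c y = ?c p" "v \<in> parents y" "p \<in> parents y"
          by iprover+
        show ?thesis by (rule insertI2) (rule K[OF False vp h'])
      qed
    qed
    moreover have "savable ?c ?C u"
    proof (cases "choosers C u = {}")
      case True
      then show ?thesis unfolding savable_def ch by simp
    next
      case False
      then have "settled c C u" "card (choosers C u) \<le> 1"
        using quiet[of u] ux u unfolding quiet_def by blast+
      then show ?thesis
        unfolding savable_def ch using settled_mono[of c C u ?c ?C]
        by (auto simp: card_insert_if finite_choosers[OF con] split: if_splits)
    qed
    moreover have "quiet ?c ?C v" if "v \<in> verts G" "?c v = None" "v \<noteq> u" for v
      using that quiet[of v] ch'[of v] quiet_mono[of c C v ?c ?C] by (auto split: if_splits)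
    ultimately have "stable_except ?c ?C u" unfolding stable_except_def using ux u by auto
    then show ?thesis by blast
  qed
qed

section \<open>From stable positions to the game\<close>

lemma ex_color_not_lost:
  assumes "stable c C \<or> stable_except c C u" and "v \<in> verts G" "c v = None"
  shows "\<exists>i<4. \<not> lost c v i"
proof -
  \<comment> \<open>An exceptional vertex is savable by definition, and every other uncolored vertex
    is quiet.\<close>
  have "consistent c C" "savable c C v"
    using assms quiet_savable unfolding stable_def stable_except_def by blast+
  then show ?thesis using ex_good_color assms(3) by blast
qed

lemma stable_empty: "stable Map.empty {}"
  unfolding stable_def consistent_def quiet_def choosers_def by simp

text \<open>No triangle was monochromatic before the move, so a new one contains
  \<open>v\<close>.\<close>

lemma legal_move_iff_lost:
  assumes "\<not> has_mono_clique G 3 (map_of h)" and "v \<in> verts G" "map_of h v = None"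
  shows "legal_move G 2 n h (v, i) \<longleftrightarrow> i < n \<and> \<not> lost (map_of h) v i"
proof -
  let ?c = "map_of h"
  have "has_mono_clique G 3 (?c(v \<mapsto> i)) \<longleftrightarrow> lost ?c v i"
  proof
    assume "has_mono_clique G 3 (?c(v \<mapsto> i))"
    then obtain K y where K: "is_clique G K" "card K = 3" "\<And>u. u \<in> K \<Longrightarrow> (?c(v \<mapsto> i)) u = Some y"
      unfolding has_mono_clique_def by blast
    have "v \<in> K"
    proof (rule ccontr)
      assume "v \<notin> K"
      then have "\<forall>u\<in>K. ?c u = Some y" using K(3) by (metis fun_upd_other)
      then show False using assms(1) K unfolding has_mono_clique_def by blast
    qed
    then have y: "y = i" using K(3)[of v] by simp
    have "card (K - {v}) = 2" using \<open>v \<in> K\<close> K(2) by simp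
    then obtain a b where ab: "K - {v} = {a, b}" "a \<noteq> b" by (meson card_2_iff)
    then have "a \<in> K" "b \<in> K" "a \<noteq> v" "b \<noteq> v" by auto
    then show "lost ?c v i"
      using K(1) K(3)[of a] K(3)[of b] y ab(2) \<open>v \<in> K\<close>
      unfolding lost_def is_clique_def by (metis fun_upd_other)
  next
    assume "lost ?c v i"
    then obtain a b where ab: "v \<rightarrow>\<^bsub>G\<^esub> a" "v \<rightarrow>\<^bsub>G\<^esub> b" "a \<rightarrow>\<^bsub>G\<^esub> b" "?c a = Some i" "?c b = Some i"
      unfolding lost_def by blast
    then have "v \<noteq> a" "v \<noteq> b" "a \<noteq> b" using not_adj_self by auto
    then have "card {v, a, b} = 3" by simp
    moreover have "is_clique G {v, a, b}"
      using ab adj_in_verts adj_sym unfolding is_clique_def by blast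
    moreover have "\<forall>u\<in>{v, a, b}. (?c(v \<mapsto> i)) u = Some i" using ab by simp
    ultimately show "has_mono_clique G 3 (?c(v \<mapsto> i))" unfolding has_mono_clique_def by blast
  qed
  then show ?thesis using assms unfolding legal_move_def by (auto simp: numeral_3_eq_3)
qed

lemma map_of_snoc: "map_of h v = None \<Longrightarrow> map_of (h @ [(v, i)]) = (map_of h)(v \<mapsto> i)"
  by (auto simp: map_add_def split: option.splits)

theorem alice_wins_4: "alice_wins G 2 4"
proof -
  \<comment> \<open>The relation \<open>C\<close> is not recorded in the history: the strategy only
    asks that some \<open>C\<close> make the new position stable.\<close>
  define \<sigma> where
    "\<sigma> h = (SOME m. legal_move G 2 4 h m \<and> (\<exists>C. stable (map_of (h @ [m])) C))" for h
  have no_mono: "\<not> has_mono_clique G 3 (map_of h)" if "play G 2 4 \<sigma> h" for h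
    using play_invariant[OF that] by (simp add: numeral_3_eq_3)
  have \<sigma>: "legal_move G 2 4 h (\<sigma> h) \<and> (\<exists>C. stable (map_of (h @ [\<sigma> h])) C)"
    if h: "play G 2 4 \<sigma> h" "\<not> game_over G 2 4 h"
      "\<exists>C u. stable (map_of h) C \<or> stable_except (map_of h) C u" for h
  proof -
    obtain w where "w \<in> verts G" "map_of h w = None"
      using h(2) unfolding game_over_def all_colored_def by blast
    then obtain z i C where z: "z \<in> verts G" "i < 4" "map_of h z = None" "\<not> lost (map_of h) z i"
        "stable ((map_of h)(z \<mapsto> i)) C"
      using h(3) stable_reply[of "map_of h"] stable_except_reply[of "map_of h"] by blast
    then have "legal_move G 2 4 h (z, i) \<and> (\<exists>C. stable (map_of (h @ [(z, i)])) C)"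
      using legal_move_iff_lost[OF no_mono[OF h(1)]] map_of_snoc by metis
    then show ?thesis unfolding \<sigma>_def by (rule someI)
  qed
  \<comment> \<open>At even length Alice is to move, and Bob may have left an exceptional vertex; at
    odd length she has just restored stability.\<close>
  have inv: "(if even (length h) then \<exists>C u. stable (map_of h) C \<or> stable_except (map_of h) C u
      else \<exists>C. stable (map_of h) C)" if "play G 2 4 \<sigma> h" for h
    using that
  proof induction
    case start
    then show ?case using stable_empty by auto
  next
    case (alice h)
    then show ?case using \<sigma> by simp
  next
    case (bob h m)
    obtain x i where m: "m = (x, i)" by fastforce
    then have x: "x \<in> verts G" "map_of h x = None" using bob.hyps unfolding legal_move_def by auto
    then have "\<exists>C u. stable ((map_of h)(x \<mapsto> i)) C \<or> stable_except ((map_of h)(x \<mapsto> i)) C u"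
      using stable_after_bob_move bob by (metis (mono_tags))
    then show ?case using m map_of_snoc[OF x(2)] bob.hyps by simp
  qed
  then have pos: "\<exists>C u. stable (map_of h) C \<or> stable_except (map_of h) C u" if "play G 2 4 \<sigma> h" for h
    using that by (metis (full_types))
  have "\<not> bob_has_won G 2 4 h" if "play G 2 4 \<sigma> h" for h
    using pos[OF that] ex_color_not_lost legal_move_iff_lost[OF no_mono[OF that]]
    unfolding bob_has_won_def by metis
  then have "winning_strategy G 2 4 \<sigma>"
    unfolding winning_strategy_def using \<sigma> pos by (auto simp: game_over_def)
  then show ?thesis unfolding alice_wins_def by blast
qed

end

section \<open>Chordal graphs with clique number 3\<close>

theorem theorem3p6:
  fixes H :: "('a, 'b) pre_digraph"
  assumes "graph H"
    and "chordal H"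
    and "clique_number H = 3"
  shows "game_chromatic_number 2 H \<le> 4"
proof -
  interpret graph H by fact
  obtain r :: "'a \<Rightarrow> nat" where r: "inj_on r (verts H)"
    "\<And>v. v \<in> verts H \<Longrightarrow> is_clique H {u \<in> verts H. u \<rightarrow>\<^bsub>H\<^esub> v \<and> r u < r v}"
    using ex_elimination_rank[OF assms(2), of "verts H"] by blast
  have clique3: "card K \<le> 3" if "is_clique H K" for K
  proof -
    \<comment> \<open>\<open>Max\<close> is an upper bound only for a finite set, so finiteness of
      the set of clique sizes comes first.\<close>
    have "{card K |K. is_clique H K} \<subseteq> card ` Pow (verts H)"
      unfolding is_clique_def by auto
    then have "finite {card K |K. is_clique H K}" by (rule finite_subset) simp
    then have "card K \<le> clique_number H"
      unfolding clique_number_def using that by (intro Max_ge) auto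
    then show ?thesis using assms(3) by simp
  qed
  interpret ranked_graph H r
  proof
    fix v assume v: "v \<in> verts H"
    let ?P = "{u \<in> verts H. u \<rightarrow>\<^bsub>H\<^esub> v \<and> r u < r v}"
    \<comment> \<open>A vertex forms a clique with its earlier neighbors, so there are at most two
      of them.\<close>
    have "is_clique H (insert v ?P)"
      using r(2)[OF v] v adj_sym unfolding is_clique_def by blast
    then have "card (insert v ?P) \<le> 3" by (rule clique3)
    then show "card ?P \<le> 2" by simp
  qed (use r in auto)
  show ?thesis
    unfolding game_chromatic_number_def using alice_wins_4 by (rule Least_le)
qed

end
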